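(* Let $\gamma\in(0,1)$ and let $|\mathrm{Ee}\rangle_{AB}=\sqrt{\gamma}|00\rangle_{AB}+\sqrt{1-\gamma}|11\rangle_{AB}$. The states in $\mathbb{C}^2\otimes\mathbb{C}^2$ that are entangled, non-diagonal, and orthogonal to $|\mathrm{Ee}\rangle_{AB}$ are exactly the states characterized by three complex numbers $a,b,c$ satisfying $$\frac{1}{1-\gamma}|a|^2+|b|^2+|c|^2=1,\qquad \sqrt{\gamma}\,a^2+\sqrt{1-\gamma}\,bc\neq 0,\qquad \sqrt{\gamma}\,ac^*-\sqrt{1-\gamma}\,a^*b\neq 0,$$ through the Schmidt decomposition $$|\mathrm{eE}\rangle_{AB}=\sum_{j=0}^1\delta_j\left(\frac{|x_j\rangle_A}{\||x_j\rangle\|}\right)\otimes\left(\frac{|y_j^*\rangle_B}{\||y_j\rangle\|}\right),$$ where $$\delta_j=\frac{1}{\sqrt{2}}\left(1+(-1)^j\sqrt{1-4\left|\frac{\sqrt{\gamma}}{\sqrt{1-\gamma}}a^2+bc\right|^2}\right)^{1/2},$$ $$|y_j\rangle=\begin{bmatrix}a^*b-\frac{\sqrt{\gamma}}{\sqrt{1-\gamma}}ac^*\\ \delta_j^2-|a|^2-|c|^2\end{bmatrix},\qquad |x_j\rangle=\begin{bmatrix}a&b\\c&-\frac{\sqrt{\gamma}}{\sqrt{1-\gamma}}a\end{bmatrix}|y_j\rangle.$$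
   Context: $|0\rangle,|1\rangle$ is the standard basis of $\mathbb{C}^2$, $|jk\rangle_{AB}=|j\rangle_A\otimes|k\rangle_B$, column vectors are with respect to the standard basis, $^*$ on scalars is complex conjugation, and $|y^*\rangle$ is the entrywise complex conjugate of $|y\rangle$. A state is a unit vector; a state in $\mathbb{C}^2\otimes\mathbb{C}^2$ is a product state if it equals $|u\rangle\otimes|v\rangle$, and entangled otherwise. A state $\sum_{j,k}c_{jk}|jk\rangle_{AB}$ is called diagonal if $c_{00}^*c_{01}+c_{10}^*c_{11}=0$, and non-diagonal otherwise. A Schmidt decomposition of a state is an expression $\sum_j\lambda_j|u_j\rangle\otimes|v_j\rangle$ with $\lambda_j\ge 0$ (the Schmidt coefficients) and $\{|u_j\rangle\}$, $\{|v_j\rangle\}$ orthonormal families in $\mathbb{C}^2$. *)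

theory Defs
  imports "HOL-Analysis.Analysis"
begin

text \<open>
  The qubit space is \<^typ>\<open>complex ^ 2\<close>. Its two indices are written \<open>0\<close> and \<open>1\<close>, so that
  \<open>ket j\<close> is \<open>|j\<rangle>\<close>. In the numeral type \<open>2\<close> one has \<open>2 = 0\<close>, so the library's
  \<open>vector [p, q]\<close> would put \<open>p\<close> at index \<open>1\<close> and \<open>q\<close> at index \<open>0\<close>; it is not used here.
  The tensor product of two qubit spaces is \<^typ>\<open>complex ^ (2 \<times> 2)\<close>, where the
  component at \<open>(j, k)\<close> is the coefficient of \<open>|j\<rangle> \<otimes> |k\<rangle>\<close>.
\<close>

type_synonym qubit = "complex ^ 2"
type_synonym two_qubit = "complex ^ (2 \<times> 2)"

definition ket :: "2 \<Rightarrow> qubit" where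
  "ket j = axis j 1"

definition tensor :: "qubit \<Rightarrow> qubit \<Rightarrow> two_qubit" where
  "tensor u v = (\<chi> p. u $ fst p * v $ snd p)"

definition col2 :: "complex \<Rightarrow> complex \<Rightarrow> qubit" where
  "col2 p q = (\<chi> i. if i = 0 then p else q)"

definition mat2 :: "complex \<Rightarrow> complex \<Rightarrow> complex \<Rightarrow> complex \<Rightarrow> complex ^ 2 ^ 2" where
  "mat2 p q r s = (\<chi> i. if i = 0 then col2 p q else col2 r s)"

definition conj_vec :: "complex ^ 'n \<Rightarrow> complex ^ 'n" where
  "conj_vec v = (\<chi> i. cnj (v $ i))"

text \<open>
  The library's \<^const>\<open>inner\<close> on complex vectors is only the real part of the Hermitian inner
  product, and so does not express orthogonality over the complex numbers. The library's
  \<^const>\<open>norm\<close> is the Hermitian norm.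
\<close>

definition cinner :: "complex ^ 'n \<Rightarrow> complex ^ 'n \<Rightarrow> complex" where
  "cinner u v = (\<Sum>i\<in>UNIV. cnj (u $ i) * v $ i)"

definition is_state :: "complex ^ 'n \<Rightarrow> bool" where
  "is_state \<psi> \<longleftrightarrow> norm \<psi> = 1"

definition is_product :: "two_qubit \<Rightarrow> bool" where
  "is_product \<psi> \<longleftrightarrow> (\<exists>u v. \<psi> = tensor u v)"

definition is_entangled :: "two_qubit \<Rightarrow> bool" where
  "is_entangled \<psi> \<longleftrightarrow> \<not> is_product \<psi>"

definition is_diagonal :: "two_qubit \<Rightarrow> bool" where
  "is_diagonal \<psi> \<longleftrightarrow> cnj (\<psi> $ (0, 0)) * \<psi> $ (0, 1) + cnj (\<psi> $ (1, 0)) * \<psi> $ (1, 1) = 0"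

definition orthonormal_family :: "'j set \<Rightarrow> ('j \<Rightarrow> complex ^ 'n) \<Rightarrow> bool" where
  "orthonormal_family J u \<longleftrightarrow>
     (\<forall>i\<in>J. \<forall>j\<in>J. cinner (u i) (u j) = (if i = j then 1 else 0))"

definition schmidt_decomposition ::
    "'j set \<Rightarrow> ('j \<Rightarrow> real) \<Rightarrow> ('j \<Rightarrow> qubit) \<Rightarrow> ('j \<Rightarrow> qubit) \<Rightarrow> two_qubit \<Rightarrow> bool" where
  "schmidt_decomposition J l u v \<psi> \<longleftrightarrow>
     finite J \<and> (\<forall>j\<in>J. 0 \<le> l j) \<and> orthonormal_family J u \<and> orthonormal_family J v \<and>
     \<psi> = (\<Sum>j\<in>J. l j *\<^sub>R tensor (u j) (v j))"

definition Ee :: "real \<Rightarrow> two_qubit" where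
  "Ee \<gamma> = sqrt \<gamma> *\<^sub>R tensor (ket 0) (ket 0) + sqrt (1 - \<gamma>) *\<^sub>R tensor (ket 1) (ket 1)"

definition admissible :: "real \<Rightarrow> complex \<Rightarrow> complex \<Rightarrow> complex \<Rightarrow> bool" where
  "admissible \<gamma> a b c \<longleftrightarrow>
     1 / (1 - \<gamma>) * (cmod a)\<^sup>2 + (cmod b)\<^sup>2 + (cmod c)\<^sup>2 = 1 \<and>
     complex_of_real (sqrt \<gamma>) * a\<^sup>2 + complex_of_real (sqrt (1 - \<gamma>)) * b * c \<noteq> 0 \<and>
     complex_of_real (sqrt \<gamma>) * a * cnj c - complex_of_real (sqrt (1 - \<gamma>)) * cnj a * b \<noteq> 0"

definition ratio :: "real \<Rightarrow> complex" where
  "ratio \<gamma> = complex_of_real (sqrt \<gamma> / sqrt (1 - \<gamma>))"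

definition delta :: "real \<Rightarrow> complex \<Rightarrow> complex \<Rightarrow> complex \<Rightarrow> nat \<Rightarrow> real" where
  "delta \<gamma> a b c j =
     1 / sqrt 2 * sqrt (1 + (-1) ^ j * sqrt (1 - 4 * (cmod (ratio \<gamma> * a\<^sup>2 + b * c))\<^sup>2))"

definition y_vec :: "real \<Rightarrow> complex \<Rightarrow> complex \<Rightarrow> complex \<Rightarrow> nat \<Rightarrow> qubit" where
  "y_vec \<gamma> a b c j =
     col2 (cnj a * b - ratio \<gamma> * a * cnj c)
          (complex_of_real ((delta \<gamma> a b c j)\<^sup>2 - (cmod a)\<^sup>2 - (cmod c)\<^sup>2))"

definition x_vec :: "real \<Rightarrow> complex \<Rightarrow> complex \<Rightarrow> complex \<Rightarrow> nat \<Rightarrow> qubit" where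
  "x_vec \<gamma> a b c j = mat2 a b c (- ratio \<gamma> * a) *v y_vec \<gamma> a b c j"

definition left_vec :: "real \<Rightarrow> complex \<Rightarrow> complex \<Rightarrow> complex \<Rightarrow> nat \<Rightarrow> qubit" where
  "left_vec \<gamma> a b c j = x_vec \<gamma> a b c j /\<^sub>R norm (x_vec \<gamma> a b c j)"

definition right_vec :: "real \<Rightarrow> complex \<Rightarrow> complex \<Rightarrow> complex \<Rightarrow> nat \<Rightarrow> qubit" where
  "right_vec \<gamma> a b c j = conj_vec (y_vec \<gamma> a b c j) /\<^sub>R norm (y_vec \<gamma> a b c j)"

definition eE :: "real \<Rightarrow> complex \<Rightarrow> complex \<Rightarrow> complex \<Rightarrow> two_qubit" where
  "eE \<gamma> a b c =
     (\<Sum>j=0..1. delta \<gamma> a b c j *\<^sub>R tensor (left_vec \<gamma> a b c j) (right_vec \<gamma> a b c j))"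

end

theory Submission
  imports Defs
begin

text \<open>
  Reading the coefficients of a two-qubit state as a matrix \<open>M\<close>, orthogonality to \<open>Ee\<close> makes the lower
  right entry \<open>- ratio \<gamma> * a\<close>, a product state is one with \<open>det M = 0\<close>, and a diagonal state is one
  whose Gram matrix \<open>M\<^sup>* M\<close> is diagonal. The Gram matrix has trace 1 and determinant \<open>|det M|\<^sup>2\<close>,
  hence eigenvalues \<open>\<delta>\<^sub>j\<^sup>2\<close>, which are distinct because its off-diagonal entry does not vanish;
  \<open>y\<^sub>j\<close> are the eigenvectors. The singular value decomposition of \<open>M\<close> given by the normalised \<open>y\<^sub>j\<close> and
  \<open>x\<^sub>j = M y\<^sub>j\<close> is the Schmidt decomposition.
\<close>

section \<open>Index sums, the Hermitian inner product and orthonormal families\<close>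

lemma UNIV_two: "(UNIV :: 2 set) = {0, 1}"
  using exhaust_2 by force

lemma sum_two: "(\<Sum>i\<in>(UNIV :: 2 set). f i) = f 0 + f 1"
  by (simp add: UNIV_two)

lemma sum_two_two: "(\<Sum>p\<in>(UNIV :: (2 \<times> 2) set). f p) = f (0, 0) + f (0, 1) + f (1, 0) + f (1, 1)"
proof -
  have "(\<Sum>p\<in>(UNIV :: (2 \<times> 2) set). f p) = (\<Sum>i\<in>UNIV. \<Sum>j\<in>UNIV. f (i, j))"
    by (simp add: sum.cartesian_product)
  then show ?thesis
    by (simp add: sum_two add.assoc)
qed

lemma forall_two: "(\<forall>i :: 2. P i) \<longleftrightarrow> P 0 \<and> P 1"
  using UNIV_two by (metis UNIV_I empty_iff insert_iff)

lemma cinner_self: "cinner v v = complex_of_real ((norm v)\<^sup>2)"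
proof -
  have "(norm v)\<^sup>2 = (\<Sum>i\<in>UNIV. (cmod (v $ i))\<^sup>2)"
    by (simp add: norm_vec_def L2_set_def sum_nonneg)
  then show ?thesis
    unfolding cinner_def by (simp add: complex_norm_square mult.commute flip: of_real_power)
qed

lemma cinner_scaleR: "cinner (r *\<^sub>R u) (s *\<^sub>R v) = complex_of_real (r * s) * cinner u v"
  unfolding cinner_def by (simp add: sum_distrib_left scaleR_conv_of_real[where 'a = complex] ac_simps)

lemma cinner_conj_vec: "cinner (conj_vec u) (conj_vec v) = cnj (cinner u v)"
  unfolding cinner_def conj_vec_def by simp

lemma orthonormal_family_normalize:
  assumes "\<And>i j. i \<in> J \<Longrightarrow> j \<in> J \<Longrightarrow> i \<noteq> j \<Longrightarrow> cinner (u i) (u j) = 0"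
    and "\<And>j. j \<in> J \<Longrightarrow> u j \<noteq> 0"
  shows "orthonormal_family J (\<lambda>j. u j /\<^sub>R norm (u j))"
  unfolding orthonormal_family_def
  using assms by (auto simp: cinner_scaleR cinner_self power2_eq_square field_simps simp flip: of_real_mult)

lemma orthonormal_family_conj_vec:
  assumes "orthonormal_family J u"
  shows "orthonormal_family J (\<lambda>j. conj_vec (u j))"
  using assms unfolding orthonormal_family_def by (simp add: cinner_conj_vec)

text \<open>Two orthonormal vectors form the columns of a square matrix \<open>V\<close> whose
  adjoint \<open>W\<close> is a left inverse. A left inverse of a square matrix is also a right
  inverse, and the entries of \<open>V ** W\<close> give the completeness relation.\<close>

lemma orthonormal_family_complete:
  fixes v :: "nat \<Rightarrow> qubit"
  assumes "orthonormal_family {0..1} v"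
  shows "(\<Sum>j=0..1. v j $ k * cnj (v j $ l)) = (if k = l then 1 else 0)"
proof -
  \<comment> \<open>The family is indexed by naturals and matrix columns by the type
    \<open>2\<close>, so the index is translated by hand.\<close>
  define V :: "complex ^ 2 ^ 2" where "V = (\<chi> k j. v (if j = 0 then 0 else 1) $ k)"
  define W :: "complex ^ 2 ^ 2" where "W = (\<chi> j k. cnj (v (if j = 0 then 0 else 1) $ k))"
  have "W ** V = mat 1"
    using assms
    unfolding orthonormal_family_def cinner_def V_def W_def
    by (simp add: vec_eq_iff matrix_matrix_mult_def mat_def forall_two sum_two)
  then have "V ** W = mat 1"
    by (simp add: matrix_left_right_inverse)
  then have "(V ** W) $ k $ l = (if k = l then 1 else 0)"
    by (simp add: mat_def)
  then show ?thesis
    by (simp add: V_def W_def matrix_matrix_mult_def sum_two)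
qed

section \<open>Coefficient matrices and their singular value decomposition\<close>

definition state_of_mat :: "complex ^ 2 ^ 2 \<Rightarrow> two_qubit" where
  "state_of_mat M = (\<chi> p. M $ fst p $ snd p)"

text \<open>By completeness, the sum of \<open>(M *v v j)\<close> times the adjoint of
  \<open>v j\<close> is \<open>M\<close> times the identity. Since \<open>tensor\<close> is
  bilinear, that adjoint appears as \<open>conj_vec (v j)\<close> in the second factor.\<close>

lemma state_of_mat_singular_value_decomposition:
  fixes v :: "nat \<Rightarrow> qubit"
  assumes "orthonormal_family {0..1} v"
    and "\<And>j. j \<in> {0..1} \<Longrightarrow> l j *\<^sub>R u j = M *v v j"
  shows "(\<Sum>j=0..1. l j *\<^sub>R tensor (u j) (conj_vec (v j))) = state_of_mat M"
proof -
  have "(\<Sum>j=0..1. l j *\<^sub>R tensor (u j) (conj_vec (v j))) $ (k, m) = M $ k $ m" for k m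
  proof -
    have "(\<Sum>j=0..1. l j *\<^sub>R tensor (u j) (conj_vec (v j))) $ (k, m)
        = (\<Sum>j=0..1. (l j *\<^sub>R u j) $ k * cnj (v j $ m))"
      by (simp add: tensor_def conj_vec_def)
    also have "\<dots> = (\<Sum>j=0..1. (M *v v j) $ k * cnj (v j $ m))"
      using assms(2) by simp
    also have "\<dots> = (\<Sum>j=0..1. \<Sum>i\<in>UNIV. M $ k $ i * (v j $ i * cnj (v j $ m)))"
      by (simp add: matrix_vector_mult_def sum_distrib_right mult.assoc)
    also have "\<dots> = (\<Sum>i\<in>UNIV. M $ k $ i * (\<Sum>j=0..1. v j $ i * cnj (v j $ m)))"
      by (subst sum.swap) (simp only: sum_distrib_left)
    also have "\<dots> = M $ k $ m"
      unfolding orthonormal_family_complete[OF assms(1)] by (simp add: if_distrib cong: if_cong)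
    finally show ?thesis .
  qed
  then show ?thesis
    by (simp add: vec_eq_iff state_of_mat_def)
qed

lemma matrix_vector_mult_scaleR_right:
  fixes M :: "complex ^ 'n ^ 'm"
  shows "M *v (r *\<^sub>R z) = r *\<^sub>R (M *v z)"
  by (simp add: matrix_vector_mult_def vec_eq_iff scaleR_sum_right)

section \<open>Product states, normalisation and orthogonality in terms of coefficients\<close>

lemma is_product_iff:
  "is_product \<psi> \<longleftrightarrow> \<psi> $ (0, 0) * \<psi> $ (1, 1) = \<psi> $ (0, 1) * \<psi> $ (1, 0)"
proof
  assume "is_product \<psi>"
  then show "\<psi> $ (0, 0) * \<psi> $ (1, 1) = \<psi> $ (0, 1) * \<psi> $ (1, 0)"
    by (auto simp: is_product_def tensor_def)
next
  assume det: "\<psi> $ (0, 0) * \<psi> $ (1, 1) = \<psi> $ (0, 1) * \<psi> $ (1, 0)"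
  have "\<exists>u v. \<forall>i j. \<psi> $ (i, j) = u $ i * v $ j"
  proof (cases "\<psi> $ (0, 0) = 0 \<and> \<psi> $ (0, 1) = 0")
    case True
    then show ?thesis
      by (intro exI[of _ "col2 0 1"] exI[of _ "col2 (\<psi> $ (1, 0)) (\<psi> $ (1, 1))"])
        (simp add: forall_two col2_def)
  next
    case False
    \<comment> \<open>The first row of coefficients is nonzero here, so the vanishing determinant
      makes the second row a multiple of it. The factor \<open>k\<close> is read off from a column
      where the first row does not vanish.\<close>
    define k where
      "k = (if \<psi> $ (0, 0) = 0 then \<psi> $ (1, 1) / \<psi> $ (0, 1) else \<psi> $ (1, 0) / \<psi> $ (0, 0))"
    have "\<psi> $ (1, 0) = k * \<psi> $ (0, 0)" "\<psi> $ (1, 1) = k * \<psi> $ (0, 1)"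
      using det False by (auto simp: k_def field_simps)
    then show ?thesis
      by (intro exI[of _ "col2 1 k"] exI[of _ "col2 (\<psi> $ (0, 0)) (\<psi> $ (0, 1))"])
        (simp add: forall_two col2_def)
  qed
  then show "is_product \<psi>"
    by (auto simp: is_product_def tensor_def vec_eq_iff)
qed

lemma is_state_iff: "is_state \<psi> \<longleftrightarrow> (\<Sum>i\<in>UNIV. (cmod (\<psi> $ i))\<^sup>2) = 1"
  by (simp add: is_state_def norm_vec_def L2_set_def)

lemma cinner_Ee:
  "cinner (Ee \<gamma>) \<psi> =
     complex_of_real (sqrt \<gamma>) * \<psi> $ (0, 0) + complex_of_real (sqrt (1 - \<gamma>)) * \<psi> $ (1, 1)"
  by (simp add: cinner_def sum_two_two Ee_def tensor_def ket_def axis_def scaleR_conv_of_real[where 'a = complex])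

section \<open>The Gram matrix of a 2 by 2 matrix, and admissibility in its terms\<close>

lemma gram_det:
  fixes a b c d :: complex
  shows "((cmod a)\<^sup>2 + (cmod c)\<^sup>2) * ((cmod b)\<^sup>2 + (cmod d)\<^sup>2) - (cmod (cnj a * b + cnj c * d))\<^sup>2
    = (cmod (a * d - b * c))\<^sup>2"
proof -
  have "complex_of_real (((cmod a)\<^sup>2 + (cmod c)\<^sup>2) * ((cmod b)\<^sup>2 + (cmod d)\<^sup>2)
      - (cmod (cnj a * b + cnj c * d))\<^sup>2) = complex_of_real ((cmod (a * d - b * c))\<^sup>2)"
    by (simp add: complex_norm_square algebra_simps del: of_real_power)
  then show ?thesis
    by (simp only: of_real_eq_iff)
qed

text \<open>The Gram matrix has rows \<open>(A, q)\<close> and \<open>(cnj q, B)\<close>. The vector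
  with entries \<open>q\<close> and \<open>s - A\<close> solves the first row of the eigenvalue
  equation for any \<open>s\<close>; the second row is the characteristic equation. Pairing with an
  arbitrary \<open>z\<close> expresses the eigenvalue equation without forming the adjoint
  matrix.\<close>

lemma gram_eigenvector:
  fixes a b c d :: complex and s :: real and z :: qubit
  defines "A \<equiv> (cmod a)\<^sup>2 + (cmod c)\<^sup>2" and "B \<equiv> (cmod b)\<^sup>2 + (cmod d)\<^sup>2"
    and "q \<equiv> cnj a * b + cnj c * d"
  assumes "s\<^sup>2 - (A + B) * s + (A * B - (cmod q)\<^sup>2) = 0"
  shows "cinner (mat2 a b c d *v z) (mat2 a b c d *v col2 q (complex_of_real (s - A)))
    = complex_of_real s * cinner z (col2 q (complex_of_real (s - A)))"
proof -
  have A: "complex_of_real A = a * cnj a + c * cnj c"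
    and B: "complex_of_real B = b * cnj b + d * cnj d"
    by (simp_all add: A_def B_def flip: complex_norm_square)
  have "complex_of_real (s\<^sup>2 - (A + B) * s + (A * B - (cmod q)\<^sup>2)) = 0"
    using assms(4) by simp
  then have "complex_of_real s * s - (complex_of_real A + B) * s
      + (complex_of_real A * B - q * cnj q) = 0"
    by (simp add: power2_eq_square flip: complex_norm_square)
  \<comment> \<open>This is the second row of the eigenvalue equation.\<close>
  then have ch: "cnj q * q + complex_of_real B * (complex_of_real s - complex_of_real A)
      = complex_of_real s * (complex_of_real s - complex_of_real A)"
    by (simp add: algebra_simps)
  have cq: "cnj q = a * cnj b + c * cnj d"
    by (simp add: q_def)
  define t where "t = complex_of_real s - complex_of_real A"
  have "cinner (mat2 a b c d *v z) (mat2 a b c d *v col2 q t)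
    = cnj (z $ 0) * (complex_of_real A * q + q * t)
      + cnj (z $ 1) * (cnj q * q + complex_of_real B * t)"
    unfolding A B cq
    by (simp add: cinner_def sum_two matrix_vector_mult_def mat2_def col2_def q_def algebra_simps)
  also have "\<dots> = cnj (z $ 0) * (complex_of_real s * q) + cnj (z $ 1) * (complex_of_real s * t)"
    unfolding ch[folded t_def] by (simp add: t_def algebra_simps)
  finally show ?thesis
    by (simp add: t_def cinner_def sum_two col2_def algebra_simps)
qed

text \<open>The weight \<open>1 / (1 - \<gamma>)\<close> collects the contributions of
  \<open>a\<close> and \<open>d\<close> to the norm. The two remaining expressions are the
  determinant and the off-diagonal Gram entry, each times \<open>- sqrt (1 - \<gamma>)\<close>,
  which is nonzero.\<close>

lemma admissible_iff:
  fixes a b c :: complex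
  assumes "\<gamma> \<in> {0<..<1}"
  defines "d \<equiv> - ratio \<gamma> * a"
  shows "admissible \<gamma> a b c \<longleftrightarrow>
    (cmod a)\<^sup>2 + (cmod c)\<^sup>2 + ((cmod b)\<^sup>2 + (cmod d)\<^sup>2) = 1 \<and>
    a * d - b * c \<noteq> 0 \<and> cnj a * b + cnj c * d \<noteq> 0"
proof -
  have "(cmod d)\<^sup>2 = \<gamma> / (1 - \<gamma>) * (cmod a)\<^sup>2"
    using assms by (simp add: ratio_def norm_mult norm_divide power_mult_distrib power_divide)
  moreover have "(cmod a)\<^sup>2 + \<gamma> / (1 - \<gamma>) * (cmod a)\<^sup>2 = 1 / (1 - \<gamma>) * (cmod a)\<^sup>2"
    using assms(1) by (simp add: field_simps)
  ultimately have 1: "(cmod a)\<^sup>2 + (cmod c)\<^sup>2 + ((cmod b)\<^sup>2 + (cmod d)\<^sup>2)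
      = 1 / (1 - \<gamma>) * (cmod a)\<^sup>2 + (cmod b)\<^sup>2 + (cmod c)\<^sup>2"
    by argo
  have 2: "complex_of_real (sqrt \<gamma>) * a\<^sup>2 + complex_of_real (sqrt (1 - \<gamma>)) * b * c
      = - complex_of_real (sqrt (1 - \<gamma>)) * (a * d - b * c)"
    using assms by (simp add: ratio_def field_simps power2_eq_square)
  have 3: "complex_of_real (sqrt \<gamma>) * a * cnj c - complex_of_real (sqrt (1 - \<gamma>)) * cnj a * b
      = - complex_of_real (sqrt (1 - \<gamma>)) * (cnj a * b + cnj c * d)"
    using assms by (simp add: ratio_def field_simps)
  show ?thesis
    using assms(1) unfolding admissible_def 1 2 3 by simp
qed

section \<open>Spectral data of the Gram matrix for an admissible triple\<close>

context
  fixes \<gamma> :: real and a b c :: complex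
  assumes \<gamma>: "\<gamma> \<in> {0<..<1}" and adm: "admissible \<gamma> a b c"
begin

text \<open>The matrix has rows \<open>(a, b)\<close> and \<open>(c, d)\<close>; \<open>A\<close>
  and \<open>B\<close> are the diagonal entries of its Gram matrix, \<open>q\<close> is the upper
  off-diagonal one, and \<open>D\<close> is minus the determinant of the matrix itself.\<close>

private abbreviation (input) "d \<equiv> - ratio \<gamma> * a"
private abbreviation (input) "A \<equiv> (cmod a)\<^sup>2 + (cmod c)\<^sup>2"
private abbreviation (input) "B \<equiv> (cmod b)\<^sup>2 + (cmod d)\<^sup>2"
private abbreviation (input) "q \<equiv> cnj a * b + cnj c * d"
private abbreviation (input) "D \<equiv> ratio \<gamma> * a\<^sup>2 + b * c"

lemma gram_trace: "A + B = 1"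
  and gram_offdiag: "q \<noteq> 0"
  using adm unfolding admissible_iff[OF \<gamma>] by blast+

lemma det_eq: "a * d - b * c = - D"
  by (simp add: power2_eq_square algebra_simps)

lemma det_nonzero: "D \<noteq> 0"
  using adm unfolding admissible_iff[OF \<gamma>] det_eq neg_equal_0_iff_equal by blast

lemma gram_det_eq: "A * B - (cmod q)\<^sup>2 = (cmod D)\<^sup>2"
  using gram_det[of a c b d] unfolding det_eq norm_minus_cancel .

text \<open>For trace 1, this is the discriminant of the characteristic polynomial of the Gram
  matrix. It equals \<open>(A - B)\<^sup>2 + 4 * (cmod q)\<^sup>2\<close>, and \<open>q\<close> is
  nonzero.\<close>

lemma discriminant_pos: "1 - 4 * (cmod D)\<^sup>2 > 0"
proof -
  have "1 - 4 * (cmod D)\<^sup>2 = (A + B)\<^sup>2 - 4 * (A * B - (cmod q)\<^sup>2)"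
    unfolding gram_trace gram_det_eq by simp
  also have "\<dots> = (A - B)\<^sup>2 + 4 * (cmod q)\<^sup>2"
    by (simp add: power2_eq_square algebra_simps)
  also have "\<dots> > 0"
    using gram_offdiag by (intro add_nonneg_pos) auto
  finally show ?thesis .
qed

lemma discriminant_less_1: "1 - 4 * (cmod D)\<^sup>2 < 1"
  using det_nonzero by simp

text \<open>This is twice an eigenvalue. For \<open>j = 1\<close> strictness comes from the nonzero
  determinant, which keeps the square root below 1.\<close>

lemma gram_eigenvalue_pos:
  assumes "j \<in> {0..1}"
  shows "0 < 1 + (-1) ^ j * sqrt (1 - 4 * (cmod D)\<^sup>2)"
proof -
  define r where "r = sqrt (1 - 4 * (cmod D)\<^sup>2)"
  have "0 < r" "r < 1"
    using discriminant_less_1 discriminant_pos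
    unfolding r_def real_sqrt_gt_0_iff real_sqrt_lt_1_iff by blast+
  moreover have "j = 0 \<or> j = 1"
    using assms by auto
  ultimately show ?thesis
    unfolding r_def[symmetric] by (elim disjE) simp_all
qed

lemma delta_pos: "j \<in> {0..1} \<Longrightarrow> 0 < delta \<gamma> a b c j"
  using gram_eigenvalue_pos by (simp add: delta_def)

lemma delta_square:
  assumes "j \<in> {0..1}"
  shows "(delta \<gamma> a b c j)\<^sup>2 = (1 + (-1) ^ j * sqrt (1 - 4 * (cmod D)\<^sup>2)) / 2"
  using gram_eigenvalue_pos[OF assms] by (simp add: delta_def power_divide)

text \<open>The quadratic formula with trace 1 and determinant
  \<open>(cmod D)\<^sup>2\<close>.\<close>

lemma gram_charpoly_delta:
  assumes "j \<in> {0..1}"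
  shows "((delta \<gamma> a b c j)\<^sup>2)\<^sup>2 - (A + B) * (delta \<gamma> a b c j)\<^sup>2 + (A * B - (cmod q)\<^sup>2) = 0"
proof -
  define r where "r = (-1) ^ j * sqrt (1 - 4 * (cmod D)\<^sup>2)"
  have "r\<^sup>2 = 1 - 4 * (cmod D)\<^sup>2"
    using discriminant_pos by (simp add: r_def power_mult_distrib flip: power_mult)
  moreover have "(delta \<gamma> a b c j)\<^sup>2 = (1 + r) / 2"
    using delta_square[OF assms] by (simp add: r_def)
  ultimately have D: "(cmod D)\<^sup>2 = (1 - r\<^sup>2) / 4" and \<delta>: "(delta \<gamma> a b c j)\<^sup>2 = (1 + r) / 2"
    by simp_all
  show ?thesis
    unfolding gram_trace gram_det_eq D \<delta> by (simp add: power2_eq_square field_simps)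
qed

lemma y_vec_eq: "y_vec \<gamma> a b c j = col2 q (complex_of_real ((delta \<gamma> a b c j)\<^sup>2 - A))"
  by (simp add: y_vec_def algebra_simps)

lemma y_vec_nonzero: "y_vec \<gamma> a b c j \<noteq> 0"
proof -
  have "y_vec \<gamma> a b c j $ 0 \<noteq> 0"
    using gram_offdiag unfolding y_vec_eq col2_def by simp
  then show ?thesis
    by force
qed

text \<open>Serves twice: for distinct indices it carries orthogonality from the
  \<open>y_vec\<close> to the \<open>x_vec\<close>, and for equal indices it determines the norm of
  \<open>x_vec\<close>.\<close>

lemma cinner_x_vec:
  assumes "j \<in> {0..1}"
  shows "cinner (x_vec \<gamma> a b c i) (x_vec \<gamma> a b c j)
    = complex_of_real ((delta \<gamma> a b c j)\<^sup>2) * cinner (y_vec \<gamma> a b c i) (y_vec \<gamma> a b c j)"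
  unfolding x_vec_def y_vec_eq[of j] by (rule gram_eigenvector) (rule gram_charpoly_delta[OF assms])

lemma cinner_y_vec:
  assumes "i \<in> {0..1}" "j \<in> {0..1}" "i \<noteq> j"
  shows "cinner (y_vec \<gamma> a b c i) (y_vec \<gamma> a b c j) = 0"
proof -
  define s t where "s = (delta \<gamma> a b c i)\<^sup>2" and "t = (delta \<gamma> a b c j)\<^sup>2"
  \<comment> \<open>Vieta's relations for the two eigenvalues. They make
    \<open>(cmod q)\<^sup>2 + (s - A) * (t - A)\<close>, the inner product in question,
    vanish.\<close>
  have st: "s + t = A + B" "s * t = A * B - (cmod q)\<^sup>2"
  proof -
    have "(-1 :: real) ^ j = - ((-1) ^ i)"
      using assms by (auto simp: le_Suc_eq)
    moreover have "((-1 :: real) ^ i) * (-1) ^ i = 1"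
      by (simp flip: power_mult_distrib)
    moreover have "sqrt (1 - 4 * (cmod D)\<^sup>2) * sqrt (1 - 4 * (cmod D)\<^sup>2) = 1 - 4 * (cmod D)\<^sup>2"
      using discriminant_pos by simp
    ultimately show "s + t = A + B" "s * t = A * B - (cmod q)\<^sup>2"
      unfolding gram_trace gram_det_eq s_def t_def delta_square[OF assms(1)] delta_square[OF assms(2)]
      by (simp_all add: field_simps)
  qed
  have "(cmod q)\<^sup>2 + (s - A) * (t - A) = 0"
    using st by algebra
  then have "complex_of_real ((cmod q)\<^sup>2 + (s - A) * (t - A)) = 0"
    by (simp only: of_real_0)
  moreover have "cinner (y_vec \<gamma> a b c i) (y_vec \<gamma> a b c j)
      = complex_of_real ((cmod q)\<^sup>2 + (s - A) * (t - A))"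
    unfolding y_vec_eq cinner_def sum_two col2_def s_def[symmetric] t_def[symmetric] of_real_add
      complex_norm_square[of q]
    by (simp add: mult.commute)
  ultimately show ?thesis
    by simp
qed

lemma norm_x_vec:
  assumes "j \<in> {0..1}"
  shows "norm (x_vec \<gamma> a b c j) = delta \<gamma> a b c j * norm (y_vec \<gamma> a b c j)"
proof -
  have "(norm (x_vec \<gamma> a b c j))\<^sup>2 = (delta \<gamma> a b c j * norm (y_vec \<gamma> a b c j))\<^sup>2"
    using cinner_x_vec[OF assms, of j] unfolding cinner_self power_mult_distrib
    by (simp only: of_real_eq_iff flip: of_real_mult)
  then show ?thesis
    using delta_pos[OF assms] by (simp add: power2_eq_iff_nonneg)
qed

lemma orthonormal_y_vec:
  "orthonormal_family {0..1} (\<lambda>j. y_vec \<gamma> a b c j /\<^sub>R norm (y_vec \<gamma> a b c j))"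
  using cinner_y_vec y_vec_nonzero by (intro orthonormal_family_normalize) blast+

text \<open>Real scaling commutes with conjugation; this is the shape used in
  \<open>state_of_mat_singular_value_decomposition\<close>.\<close>

lemma right_vec_eq:
  "right_vec \<gamma> a b c j = conj_vec (y_vec \<gamma> a b c j /\<^sub>R norm (y_vec \<gamma> a b c j))"
  by (simp add: right_vec_def conj_vec_def vec_eq_iff)

lemma orthonormal_right_vec: "orthonormal_family {0..1} (right_vec \<gamma> a b c)"
  using orthonormal_family_conj_vec[OF orthonormal_y_vec] by (simp flip: right_vec_eq)

lemma orthonormal_left_vec: "orthonormal_family {0..1} (left_vec \<gamma> a b c)"
  unfolding left_vec_def
proof (rule orthonormal_family_normalize)
  fix i j :: nat
  assume "i \<in> {0..1}" "j \<in> {0..1}" "i \<noteq> j"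
  then show "cinner (x_vec \<gamma> a b c i) (x_vec \<gamma> a b c j) = 0"
    by (simp add: cinner_x_vec cinner_y_vec)
next
  fix j :: nat
  assume "j \<in> {0..1}"
  then have "norm (x_vec \<gamma> a b c j) \<noteq> 0"
    using norm_x_vec delta_pos y_vec_nonzero by (metis less_irrefl mult_eq_0_iff norm_eq_zero)
  then show "x_vec \<gamma> a b c j \<noteq> 0"
    by simp
qed

lemma schmidt_decomposition_eE:
  "schmidt_decomposition {0..1} (delta \<gamma> a b c) (left_vec \<gamma> a b c) (right_vec \<gamma> a b c) (eE \<gamma> a b c)"
  using orthonormal_left_vec orthonormal_right_vec delta_pos
  by (auto simp: schmidt_decomposition_def eE_def less_imp_le)

text \<open>Since \<open>norm_x_vec\<close> gives the norm of \<open>x_vec\<close> as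
  \<open>delta\<close> times that of \<open>y_vec\<close>, the matrix sends each normalised
  \<open>y_vec\<close> to \<open>delta\<close> times \<open>left_vec\<close>, so the sum is a
  singular value decomposition of it.\<close>

lemma eE_eq: "eE \<gamma> a b c = state_of_mat (mat2 a b c d)"
  unfolding eE_def right_vec_eq
proof (rule state_of_mat_singular_value_decomposition[OF orthonormal_y_vec])
  fix j :: nat
  assume j: "j \<in> {0..1}"
  show "delta \<gamma> a b c j *\<^sub>R left_vec \<gamma> a b c j
      = mat2 a b c d *v (y_vec \<gamma> a b c j /\<^sub>R norm (y_vec \<gamma> a b c j))"
    using delta_pos[OF j]
    unfolding left_vec_def norm_x_vec[OF j] matrix_vector_mult_scaleR_right x_vec_def[symmetric] by simp
qed

end

section \<open>Matching states with admissible triples\<close>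

lemma state_of_mat_nth [simp]:
  "state_of_mat (mat2 p q r s) $ (0, 0) = p" "state_of_mat (mat2 p q r s) $ (0, 1) = q"
  "state_of_mat (mat2 p q r s) $ (1, 0) = r" "state_of_mat (mat2 p q r s) $ (1, 1) = s"
  by (simp_all add: state_of_mat_def mat2_def col2_def)

lemma state_of_mat_surj:
  "\<psi> = state_of_mat (mat2 (\<psi> $ (0, 0)) (\<psi> $ (0, 1)) (\<psi> $ (1, 0)) (\<psi> $ (1, 1)))"
  by (simp add: vec_eq_iff forall_two)

lemma admissible_iff_state:
  fixes a b c :: complex
  assumes "\<gamma> \<in> {0<..<1}"
  defines "\<psi> \<equiv> state_of_mat (mat2 a b c (- ratio \<gamma> * a))"
  shows "admissible \<gamma> a b c \<longleftrightarrow> is_state \<psi> \<and> is_entangled \<psi> \<and> \<not> is_diagonal \<psi>"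
  unfolding admissible_iff[OF assms(1)] is_state_iff sum_two_two is_entangled_def is_product_iff
    is_diagonal_def \<psi>_def state_of_mat_nth
  by (simp add: ac_simps)

lemma cinner_Ee_eq_0_iff:
  assumes "\<gamma> \<in> {0<..<1}"
  shows "cinner (Ee \<gamma>) \<psi> = 0 \<longleftrightarrow> \<psi> $ (1, 1) = - ratio \<gamma> * \<psi> $ (0, 0)"
proof -
  have "cinner (Ee \<gamma>) \<psi> = complex_of_real (sqrt (1 - \<gamma>)) * (\<psi> $ (1, 1) - - ratio \<gamma> * \<psi> $ (0, 0))"
    using assms by (simp add: cinner_Ee ratio_def field_simps)
  then show ?thesis
    using assms by (simp add: eq_neg_iff_add_eq_0)
qed

theorem proposition8:
  fixes \<gamma> :: real
  assumes "\<gamma> \<in> {0<..<1}"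
  shows "{\<psi> :: two_qubit. is_state \<psi> \<and> is_entangled \<psi> \<and> \<not> is_diagonal \<psi> \<and> cinner (Ee \<gamma>) \<psi> = 0}
           = {eE \<gamma> a b c | a b c. admissible \<gamma> a b c}
         \<and> (\<forall>a b c. admissible \<gamma> a b c \<longrightarrow>
               schmidt_decomposition {0..1} (delta \<gamma> a b c) (left_vec \<gamma> a b c) (right_vec \<gamma> a b c)
                 (eE \<gamma> a b c))"
proof (intro conjI allI impI set_eqI iffI)
  fix \<psi> :: two_qubit
  assume "\<psi> \<in> {\<psi>. is_state \<psi> \<and> is_entangled \<psi> \<and> \<not> is_diagonal \<psi> \<and> cinner (Ee \<gamma>) \<psi> = 0}"
  then have \<psi>: "is_state \<psi>" "is_entangled \<psi>" "\<not> is_diagonal \<psi>"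
    and orth: "\<psi> $ (1, 1) = - ratio \<gamma> * \<psi> $ (0, 0)"
    using cinner_Ee_eq_0_iff[OF assms] by auto
  \<comment> \<open>The parameters are three of the coefficients; orthogonality to \<open>Ee\<close>
    fixes the fourth.\<close>
  define a b c where "a = \<psi> $ (0, 0)" and "b = \<psi> $ (0, 1)" and "c = \<psi> $ (1, 0)"
  have eq: "\<psi> = state_of_mat (mat2 a b c (- ratio \<gamma> * a))"
    using state_of_mat_surj[of \<psi>] unfolding orth a_def b_def c_def .
  then have adm: "admissible \<gamma> a b c"
    using \<psi> admissible_iff_state[OF assms] by metis
  then have "\<psi> = eE \<gamma> a b c"
    using eq eE_eq[OF assms] by simp
  with adm show "\<psi> \<in> {eE \<gamma> a b c | a b c. admissible \<gamma> a b c}"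
    by blast
next
  fix \<psi> :: two_qubit
  assume "\<psi> \<in> {eE \<gamma> a b c | a b c. admissible \<gamma> a b c}"
  then obtain a b c where adm: "admissible \<gamma> a b c" and "\<psi> = eE \<gamma> a b c"
    by blast
  then have "\<psi> = state_of_mat (mat2 a b c (- ratio \<gamma> * a))"
    using eE_eq[OF assms] by simp
  then show "\<psi> \<in> {\<psi>. is_state \<psi> \<and> is_entangled \<psi> \<and> \<not> is_diagonal \<psi> \<and> cinner (Ee \<gamma>) \<psi> = 0}"
    using adm admissible_iff_state[OF assms] cinner_Ee_eq_0_iff[OF assms] by simp
next
  fix a b c
  assume "admissible \<gamma> a b c"
  then show "schmidt_decomposition {0..1} (delta \<gamma> a b c) (left_vec \<gamma> a b c) (right_vec \<gamma> a b c)
      (eE \<gamma> a b c)"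
    by (rule schmidt_decomposition_eE[OF assms])
qed

end
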